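(* Let $\mathcal S=\{\phi_e:X\to X\}_{e\in E}$ be a finite conformal iterated function system in $\mathbb R^n$ consisting of rotation free similarities. Suppose that there exists a set $V\subset S^{n-1}$ such that $$\big(\operatorname{Int}(X)\cap(l_v+x)\big)\setminus\bigcup_{e\in E}\phi_e(X)\ne\emptyset$$ for every $x\in\bigcup_{e\in E}\phi_e(X)$ and every $v\in S^{n-1}\setminus V$. Then $J_{\mathcal S}$ is $v$-directed porous for every $v\in S^{n-1}\setminus V$.
   Context: For $v\in S^{n-1}$, $l_v$ is the line through the origin and $v$. A finite conformal iterated function system consisting of rotation free similarities means here: $E$ is a finite set with at least two elements; $X\subset\mathbb R^n$ is compact, connected and equal to the closure of its interior; each $\phi_e$ is of the form $\phi_e(x)=\lambda_ex+b_e$ with $\lambda_e\in(0,1)$, $b_e\in\mathbb R^n$, and $\phi_e(X)\subset X$; there is an open connected $W\supset X$ with $\phi_e(W)\subset W$ for all $e$; and the open set condition holds: $\phi_a(\operatorname{Int}X)\cap\phi_b(\operatorname{Int}X)=\emptyset$ for $a\ne b$ in $E$. All words over $E$ are admissible, and the limit set is $J_{\mathcal S}=\pi(E^{\mathbb N})$, where $\pi(\omega)$ is the unique point of $\bigcap_n\phi_{\omega_1}\circ\cdots\circ\phi_{\omega_n}(X)$. Directed porosity: for a bounded $G\subset\mathbb R^n$, $x\in\mathbb R^n$, $r>0$, $\operatorname{por}_v(G,x,r)=\sup\{c\ge0:B(y,cr)\subset B(x,r)\setminus G\text{ for some }y\in x+l_v\}$. $G$ is $v$-directed porous if there are $c\in(0,1)$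 and $r_0>0$ with $\operatorname{por}_v(G,x,r)\ge c$ for every $x\in G$ and $r\in(0,r_0)$. *)

theory Defs
  imports "HOL-Analysis.Analysis"
begin

definition rotation_free_similarity :: "('a::euclidean_space \<Rightarrow> 'a) \<Rightarrow> bool" where
  "rotation_free_similarity f \<longleftrightarrow>
     (\<exists>s b. 0 < s \<and> s < 1 \<and> (\<forall>x. f x = s *\<^sub>R x + b))"

text \<open>
  The maps \<open>\<phi> e\<close> are taken as affine maps of the whole space; that they map \<open>X\<close> to itself is
  the assumption \<open>maps_X\<close>. Nonemptiness of \<open>X\<close> is stated because the library predicate
  \<open>connected\<close> also holds of the empty set, for which the coding map below would be undefined.
\<close>
locale rotation_free_cifs =
  fixes E :: "'e set" and X :: "'a::euclidean_space set" and \<phi> :: "'e \<Rightarrow> 'a \<Rightarrow> 'a"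
  assumes finite_E: "finite E" and two_le_card_E: "2 \<le> card E"
    and X_nonempty: "X \<noteq> {}"
    and compact_X: "compact X" and connected_X: "connected X"
    and closure_interior_X: "X = closure (interior X)"
    and similarity: "\<And>e. e \<in> E \<Longrightarrow> rotation_free_similarity (\<phi> e)"
    and maps_X: "\<And>e. e \<in> E \<Longrightarrow> \<phi> e ` X \<subseteq> X"
    and extension: "\<exists>W. open W \<and> connected W \<and> X \<subseteq> W \<and> (\<forall>e\<in>E. \<phi> e ` W \<subseteq> W)"
    and open_set_condition:
      "\<And>a b. a \<in> E \<Longrightarrow> b \<in> E \<Longrightarrow> a \<noteq> b \<Longrightarrow> \<phi> a ` interior X \<inter> \<phi> b ` interior X = {}"

text \<open>
  Infinite words are functions on \<open>nat\<close>, so the letters are \<open>\<omega> 0, \<omega> 1, \<dots>\<close> and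
  \<open>word_map \<phi> \<omega> n\<close> is \<open>\<phi> (\<omega> 0) \<circ> \<dots> \<circ> \<phi> (\<omega> (n - 1))\<close>.
\<close>
primrec word_map :: "('e \<Rightarrow> 'a \<Rightarrow> 'a) \<Rightarrow> (nat \<Rightarrow> 'e) \<Rightarrow> nat \<Rightarrow> 'a \<Rightarrow> 'a" where
  "word_map \<phi> \<omega> 0 = id"
| "word_map \<phi> \<omega> (Suc n) = word_map \<phi> \<omega> n \<circ> \<phi> (\<omega> n)"

definition coding_map :: "'a set \<Rightarrow> ('e \<Rightarrow> 'a \<Rightarrow> 'a) \<Rightarrow> (nat \<Rightarrow> 'e) \<Rightarrow> 'a" where
  "coding_map X \<phi> \<omega> = (THE x. x \<in> (\<Inter>n\<in>{1..}. word_map \<phi> \<omega> n ` X))"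

definition limit_set :: "'e set \<Rightarrow> 'a set \<Rightarrow> ('e \<Rightarrow> 'a \<Rightarrow> 'a) \<Rightarrow> 'a set" where
  "limit_set E X \<phi> = coding_map X \<phi> ` (UNIV \<rightarrow> E)"

text \<open>For a nonzero vector \<open>v\<close>, \<open>span {v}\<close> is the line through the origin and \<open>v\<close>.\<close>
definition parallel_line :: "'a::euclidean_space \<Rightarrow> 'a \<Rightarrow> 'a set" where
  "parallel_line v x = (\<lambda>z. x + z) ` span {v}"

text \<open>
  Balls are open, so for \<open>r > 0\<close> the set below contains \<open>0\<close>; it is bounded above by \<open>1\<close>, so
  the supremum is a genuine one.
\<close>
definition directed_por :: "'a::euclidean_space \<Rightarrow> 'a set \<Rightarrow> 'a \<Rightarrow> real \<Rightarrow> real" where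
  "directed_por v G x r =
     Sup {c. 0 \<le> c \<and> (\<exists>y \<in> parallel_line v x. ball y (c * r) \<subseteq> ball x r - G)}"

definition directed_porous :: "'a::euclidean_space \<Rightarrow> 'a set \<Rightarrow> bool" where
  "directed_porous v G \<longleftrightarrow> bounded G \<and>
     (\<exists>c r0. 0 < c \<and> c < 1 \<and> 0 < r0 \<and>
        (\<forall>x\<in>G. \<forall>r. 0 < r \<and> r < r0 \<longrightarrow> c \<le> directed_por v G x r))"

end

theory Submission
  imports Defs
begin

text \<open>
  Let \<open>K\<close> be the union of the \<open>\<phi> e ` X\<close>. By compactness of \<open>K\<close>, every line in direction \<open>v\<close>
  through a point of \<open>K\<close> meets the centre of a ball of one fixed radius contained in
  \<open>interior X - K\<close>. Similarities without rotation preserve lines in direction \<open>v\<close>, so these balls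
  can be transported to all small scales. By the open set condition a ball
  inside \<open>\<phi> a ` interior X\<close> does not meet \<open>\<phi> b ` X\<close> for \<open>b \<noteq> a\<close>, so a ball inside
  \<open>interior X\<close> missing the limit set \<open>J \<subseteq> (\<Union>e. \<phi> e ` J)\<close> is mapped by \<open>\<phi> a\<close> to a ball
  missing \<open>J\<close>.
\<close>

section \<open>Lines in direction \<open>v\<close>, balls and uniform holes\<close>

lemma parallel_line_iff: "y \<in> parallel_line v x \<longleftrightarrow> (\<exists>k. y = x + k *\<^sub>R v)"
  by (auto simp: parallel_line_def span_singleton)

lemma image_ball_similarity:
  fixes b :: "'a::real_normed_vector"
  assumes "s > 0"
  shows "(\<lambda>x. s *\<^sub>R x + b) ` ball y r = ball (s *\<^sub>R y + b) (s * r)"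
proof -
  have "(\<lambda>x. s *\<^sub>R x + b) ` ball y r = (\<lambda>x. b + x) ` ((\<lambda>x. s *\<^sub>R x) ` ball y r)"
    by (simp add: image_image add.commute)
  also have "\<dots> = ball (s *\<^sub>R y + b) (s * r)"
    using assms ball_scale[of s y r] ball_translation[of b "s *\<^sub>R y" "s * r"]
    by (simp add: add.commute)
  finally show ?thesis .
qed

lemma le_directed_por:
  fixes x :: "'a::euclidean_space"
  assumes "0 \<le> c" "0 < r" "y \<in> parallel_line v x" "ball y (c * r) \<subseteq> ball x r - G"
  shows "c \<le> directed_por v G x r"
  unfolding directed_por_def
proof (rule cSup_upper)
  show "bdd_above {c. 0 \<le> c \<and> (\<exists>y\<in>parallel_line v x. ball y (c * r) \<subseteq> ball x r - G)}"
  proof (rule bdd_aboveI[where M = 1], clarify)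
    fix d z assume d: "0 \<le> d" "ball z (d * r) \<subseteq> ball x r - G"
    then have "ball z (d * r) \<subseteq> ball x r" by blast
    then have "d * r \<le> 1 * r"
      using \<open>0 < r\<close> zero_le_dist[of z x] unfolding ball_subset_ball_iff by linarith
    then show "d \<le> 1" using \<open>0 < r\<close> by simp
  qed
qed (use assms in auto)

text \<open>A hole around \<open>x + k *\<^sub>R v\<close> also serves the points near
  \<open>x\<close>: for \<open>z\<close> close to \<open>x\<close>, the translate
  \<open>z + k *\<^sub>R v\<close> lies on the line through \<open>z\<close> and is still well
  inside the hole. Compactness leaves finitely many radii to minimise over.\<close>

lemma uniform_holes:
  fixes K :: "'a::euclidean_space set"
  assumes "compact K" "open W"
    and "\<And>x. x \<in> K \<Longrightarrow> W \<inter> parallel_line v x \<noteq> {}"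
  shows "\<exists>\<rho>>0. \<forall>x\<in>K. \<exists>y\<in>parallel_line v x. ball y \<rho> \<subseteq> W"
proof (cases "K = {}")
  case False
  have "\<exists>k \<epsilon>. \<epsilon> > 0 \<and> ball (x + k *\<^sub>R v) \<epsilon> \<subseteq> W" if x: "x \<in> K" for x
  proof -
    obtain y where y: "y \<in> W" "y \<in> parallel_line v x" using assms(3) x by blast
    obtain k where "y = x + k *\<^sub>R v" using y(2) by (auto simp: parallel_line_iff)
    moreover obtain \<epsilon> where "\<epsilon> > 0" "ball y \<epsilon> \<subseteq> W"
      using y(1) \<open>open W\<close> open_contains_ball by metis
    ultimately show ?thesis by blast
  qed
  then obtain k \<epsilon> where hole: "\<And>x. x \<in> K \<Longrightarrow> \<epsilon> x > (0::real) \<and> ball (x + k x *\<^sub>R v) (\<epsilon> x) \<subseteq> W"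
    by (metis (no_types))
  \<comment> \<open>One half of \<open>\<epsilon> x\<close> pays for moving the centre from
    \<open>x\<close> to \<open>z\<close>; the other half remains as the radius of the hole.\<close>
  have "K \<subseteq> (\<Union>x\<in>K. ball x (\<epsilon> x / 2))"
    using hole by (force intro: half_gt_zero)
  then obtain F where F: "F \<subseteq> K" "finite F" "K \<subseteq> (\<Union>x\<in>F. ball x (\<epsilon> x / 2))"
    by (rule compactE_image[OF \<open>compact K\<close>, rotated]) auto
  with False have "F \<noteq> {}" by auto
  define \<rho> where "\<rho> = Min ((\<lambda>x. \<epsilon> x / 2) ` F)"
  have "\<rho> > 0" using F \<open>F \<noteq> {}\<close> hole by (auto simp: \<rho>_def)
  moreover have "\<exists>y\<in>parallel_line v z. ball y \<rho> \<subseteq> W" if "z \<in> K" for z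
  proof -
    obtain x where x: "x \<in> F" "z \<in> ball x (\<epsilon> x / 2)" using F \<open>z \<in> K\<close> by blast
    then have "\<rho> \<le> \<epsilon> x / 2" using F unfolding \<rho>_def by (intro Min_le) auto
    moreover have "dist (z + k x *\<^sub>R v) (x + k x *\<^sub>R v) < \<epsilon> x / 2"
      using x by (simp add: dist_commute)
    ultimately have "ball (z + k x *\<^sub>R v) \<rho> \<subseteq> ball (x + k x *\<^sub>R v) (\<epsilon> x)"
      by (auto simp: ball_subset_ball_iff)
    moreover have "ball (x + k x *\<^sub>R v) (\<epsilon> x) \<subseteq> W" using hole x F by blast
    ultimately have "ball (z + k x *\<^sub>R v) \<rho> \<subseteq> W" by (rule subset_trans)
    moreover have "z + k x *\<^sub>R v \<in> parallel_line v z" unfolding parallel_line_iff by blast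
    ultimately show ?thesis by (rule bexI)
  qed
  ultimately show ?thesis by blast
next
  case True
  then show ?thesis by (auto intro: exI[of _ 1])
qed

text \<open>The recursion of \<open>word_map\<close> adds letters at the innermost position, whereas
  self-similarity of the limit set needs the outermost letter split off.\<close>

lemma word_map_Suc_shift:
  "word_map \<phi> \<omega> (Suc n) = \<phi> (\<omega> 0) \<circ> word_map \<phi> (\<lambda>i. \<omega> (Suc i)) n"
  by (induction n) (simp_all add: fun_eq_iff)

context rotation_free_cifs
begin

section \<open>Contraction ratios and first-level images of \<open>X\<close>\<close>

lemma E_nonempty: "E \<noteq> {}"
  using two_le_card_E by auto

text \<open>Finiteness of \<open>E\<close> makes the bounds uniform. The upper bound
  \<open>t\<close> drives convergence along words and down the scales; the lower bound
  \<open>m\<close> limits how much a scale grows when one map is undone.\<close>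

lemma similarity_bounds:
  obtains m t :: real and s :: "'e \<Rightarrow> real" and b :: "'e \<Rightarrow> 'a"
  where "0 < m" "t < 1" "\<And>e. e \<in> E \<Longrightarrow> m \<le> s e \<and> s e \<le> t"
    "\<And>e. e \<in> E \<Longrightarrow> \<phi> e = (\<lambda>x. s e *\<^sub>R x + b e)"
proof -
  have "\<forall>e\<in>E. \<exists>s b. 0 < s \<and> s < 1 \<and> \<phi> e = (\<lambda>x. s *\<^sub>R x + b)"
    using similarity unfolding rotation_free_similarity_def fun_eq_iff by blast
  then obtain s b where sb: "\<And>e. e \<in> E \<Longrightarrow> 0 < s e \<and> s e < 1 \<and> \<phi> e = (\<lambda>x. s e *\<^sub>R x + b e)"
    by metis
  show ?thesis
    by (rule that[of "Min (s ` E)" "Max (s ` E)" s b]) (use sb finite_E E_nonempty in auto)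
qed

lemma compact_image_X:
  assumes "e \<in> E"
  shows "compact (\<phi> e ` X)"
proof -
  obtain s b where "\<phi> e = (\<lambda>x. b + s *\<^sub>R x)"
    using similarity[OF assms] unfolding rotation_free_similarity_def by (auto simp: add.commute)
  then show ?thesis using compact_affinity[OF compact_X] by simp
qed

lemma image_interior_X:
  assumes "e \<in> E"
  shows "open (\<phi> e ` interior X)" "\<phi> e ` interior X \<subseteq> interior X"
    "\<phi> e ` X \<subseteq> closure (\<phi> e ` interior X)"
proof -
  obtain s b where s: "0 < s" and \<phi>: "\<phi> e = (\<lambda>x. s *\<^sub>R x + b)"
    using similarity[OF assms] unfolding rotation_free_similarity_def by blast
  have "\<phi> e ` interior X = (\<lambda>x. b + x) ` (\<lambda>x. s *\<^sub>R x) ` interior X"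
    by (simp add: \<phi> image_image add.commute)
  then show "open (\<phi> e ` interior X)" using s by (simp add: open_scaling open_translation)
  then show "\<phi> e ` interior X \<subseteq> interior X"
    using maps_X[OF assms] interior_subset by (intro interior_maximal) blast+
  have "\<phi> e ` closure (interior X) \<subseteq> closure (\<phi> e ` interior X)"
    by (intro image_closure_subset closure_subset closed_closure) (auto simp: \<phi> intro!: continuous_intros)
  then show "\<phi> e ` X \<subseteq> closure (\<phi> e ` interior X)"
    using closure_interior_X by simp
qed

text \<open>An open set that misses the image of the interior under \<open>\<phi> b\<close> also
  misses its closure, which contains the whole image of \<open>X\<close>.\<close>

lemma interior_image_disjoint:
  assumes "a \<in> E" "b \<in> E" "a \<noteq> b"
  shows "\<phi> a ` interior X \<inter> \<phi> b ` X = {}"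
proof -
  have "\<phi> a ` interior X \<inter> closure (\<phi> b ` interior X) = {}"
    using open_Int_closure_eq_empty image_interior_X(1) open_set_condition assms by metis
  then show ?thesis using image_interior_X(3)[OF \<open>b \<in> E\<close>] by blast
qed

section \<open>The coding map and self-similarity of the limit set\<close>

lemma coding_map_unique:
  assumes "\<omega> \<in> UNIV \<rightarrow> E"
  shows "\<exists>!x. x \<in> (\<Inter>n\<in>{1..}. word_map \<phi> \<omega> n ` X)"
proof -
  obtain m t :: real and s b where st: "0 < m" "t < 1" "\<And>e. e \<in> E \<Longrightarrow> m \<le> s e \<and> s e \<le> t"
    and \<phi>: "\<And>e. e \<in> E \<Longrightarrow> \<phi> e = (\<lambda>x. s e *\<^sub>R x + b e)"
    using similarity_bounds by blast
  have \<omega>: "\<omega> n \<in> E" for n using assms by auto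
  have "0 < t" using st \<omega> by (meson less_le_trans)
  have dist_word: "dist (word_map \<phi> \<omega> n x) (word_map \<phi> \<omega> n y) \<le> t ^ n * dist x y" for n x y
  proof (induction n arbitrary: x y)
    case (Suc n)
    have "dist (\<phi> (\<omega> n) x) (\<phi> (\<omega> n) y) = \<bar>s (\<omega> n)\<bar> * dist x y"
      by (simp add: \<phi>[OF \<omega>] dist_norm flip: scaleR_diff_right)
    also have "\<dots> \<le> t * dist x y"
      using st(1) st(3)[OF \<omega>, of n] by (intro mult_right_mono) auto
    finally have "t ^ n * dist (\<phi> (\<omega> n) x) (\<phi> (\<omega> n) y) \<le> t ^ n * (t * dist x y)"
      using \<open>0 < t\<close> by (intro mult_left_mono) auto
    then show ?case using Suc[of "\<phi> (\<omega> n) x" "\<phi> (\<omega> n) y"] by (simp add: mult_ac)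
  qed simp
  have step: "word_map \<phi> \<omega> (Suc n) ` X \<subseteq> word_map \<phi> \<omega> n ` X" for n
    using maps_X[OF \<omega>, of n] by (auto simp: image_comp[symmetric])
  have "continuous_on X (word_map \<phi> \<omega> n)" for n
  proof (rule continuous_onI)
    fix x and \<epsilon> :: real assume "0 < \<epsilon>"
    assume "x \<in> X"
    show "\<exists>d>0. \<forall>x'\<in>X. dist x' x < d \<longrightarrow> dist (word_map \<phi> \<omega> n x') (word_map \<phi> \<omega> n x) \<le> \<epsilon>"
    proof (intro exI[of _ "\<epsilon> / t ^ n"] conjI ballI impI)
      fix x' assume "dist x' x < \<epsilon> / t ^ n"
      then have "t ^ n * dist x' x \<le> \<epsilon>" using \<open>0 < t\<close> by (simp add: field_simps)
      then show "dist (word_map \<phi> \<omega> n x') (word_map \<phi> \<omega> n x) \<le> \<epsilon>"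
        using dist_word order_trans by blast
    qed (use \<open>0 < t\<close> \<open>0 < \<epsilon>\<close> in simp)
  qed
  then have "compact (word_map \<phi> \<omega> n ` X)" for n
    by (intro compact_continuous_image compact_X)
  moreover have "word_map \<phi> \<omega> n ` X \<subseteq> word_map \<phi> \<omega> k ` X" if "k \<le> n" for k n
    using that by (rule lift_Suc_antimono_le[of "\<lambda>n. word_map \<phi> \<omega> n ` X", OF step])
  \<comment> \<open>The nest starts at \<open>n = 0\<close> with \<open>X\<close> itself; the
    intersection over \<open>n \<ge> 1\<close> contains this one.\<close>
  ultimately have "(\<Inter>n. word_map \<phi> \<omega> n ` X) \<noteq> {}"
    using X_nonempty by (intro compact_nest) auto
  then obtain x where "x \<in> (\<Inter>n\<in>{1..}. word_map \<phi> \<omega> n ` X)" by blast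
  moreover have "x = y" if x: "x \<in> (\<Inter>n\<in>{1..}. word_map \<phi> \<omega> n ` X)"
    and y: "y \<in> (\<Inter>n\<in>{1..}. word_map \<phi> \<omega> n ` X)" for x y
  proof -
    have "dist x y \<le> t ^ n * diameter X" if "1 \<le> n" for n
    proof -
      obtain p q where pq: "p \<in> X" "q \<in> X" "x = word_map \<phi> \<omega> n p" "y = word_map \<phi> \<omega> n q"
        using x y \<open>1 \<le> n\<close> by blast
      have "dist x y \<le> t ^ n * dist p q" using pq dist_word by simp
      also have "\<dots> \<le> t ^ n * diameter X"
        using pq \<open>0 < t\<close> compact_X
        by (intro mult_left_mono diameter_bounded_bound compact_imp_bounded) auto
      finally show ?thesis .
    qed
    moreover have "(\<lambda>n. t ^ n * diameter X) \<longlonglongrightarrow> 0"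
      using st \<open>0 < t\<close> by (intro tendsto_mult_left_zero LIMSEQ_power_zero) auto
    ultimately have "dist x y \<le> 0"
      by (intro LIMSEQ_le_const) auto
    then show ?thesis by simp
  qed
  ultimately show ?thesis by blast
qed

lemma coding_map_mem:
  assumes "\<omega> \<in> UNIV \<rightarrow> E" "1 \<le> n"
  shows "coding_map X \<phi> \<omega> \<in> word_map \<phi> \<omega> n ` X"
  using theI'[OF coding_map_unique[OF assms(1)]] assms(2) unfolding coding_map_def by blast

text \<open>The right-hand side lies in every set of the nest for \<open>\<omega>\<close>, so
  uniqueness identifies it with the coded point.\<close>

lemma coding_map_shift:
  assumes \<omega>: "\<omega> \<in> UNIV \<rightarrow> E"
  shows "coding_map X \<phi> \<omega> = \<phi> (\<omega> 0) (coding_map X \<phi> (\<lambda>i. \<omega> (Suc i)))"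
proof -
  let ?\<sigma> = "\<lambda>i. \<omega> (Suc i)" and ?p = "coding_map X \<phi> (\<lambda>i. \<omega> (Suc i))"
  have \<sigma>: "?\<sigma> \<in> UNIV \<rightarrow> E" using \<omega> by auto
  have "?p \<in> word_map \<phi> ?\<sigma> 1 ` X" using coding_map_mem[OF \<sigma>] by blast
  then have "?p \<in> X" using maps_X[of "\<omega> 1"] \<omega> by auto
  \<comment> \<open>The case \<open>n = 0\<close>, membership in \<open>X\<close>, lies outside
    \<open>coding_map_mem\<close> and supplies level 1 for \<open>\<omega>\<close> below.\<close>
  then have p: "?p \<in> word_map \<phi> ?\<sigma> n ` X" for n
    using coding_map_mem[OF \<sigma>, of n] by (cases n) auto
  have "\<phi> (\<omega> 0) ?p \<in> word_map \<phi> \<omega> n ` X" if "1 \<le> n" for n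
  proof -
    obtain k where "n = Suc k" using \<open>1 \<le> n\<close> by (cases n) auto
    then show ?thesis
      using p[of k] by (auto simp: word_map_Suc_shift image_comp[symmetric] simp del: word_map.simps)
  qed
  then show ?thesis
    unfolding coding_map_def[of X \<phi> \<omega>] by (intro the1_equality coding_map_unique[OF \<omega>]) auto
qed

lemma limit_set_subset_images:
  "limit_set E X \<phi> \<subseteq> (\<Union>e\<in>E. \<phi> e ` limit_set E X \<phi>)"
proof
  fix x assume "x \<in> limit_set E X \<phi>"
  then obtain \<omega> where \<omega>: "\<omega> \<in> UNIV \<rightarrow> E" "x = coding_map X \<phi> \<omega>"
    by (auto simp: limit_set_def)
  moreover have "coding_map X \<phi> (\<lambda>i. \<omega> (Suc i)) \<in> limit_set E X \<phi>"
    unfolding limit_set_def using \<omega> by blast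
  ultimately show "x \<in> (\<Union>e\<in>E. \<phi> e ` limit_set E X \<phi>)"
    using coding_map_shift by blast
qed

lemma limit_set_subset: "limit_set E X \<phi> \<subseteq> (\<Union>e\<in>E. \<phi> e ` X)"
proof
  fix x assume "x \<in> limit_set E X \<phi>"
  then obtain \<omega> where \<omega>: "\<omega> \<in> UNIV \<rightarrow> E" "x = coding_map X \<phi> \<omega>"
    by (auto simp: limit_set_def)
  then show "x \<in> (\<Union>e\<in>E. \<phi> e ` X)"
    using coding_map_mem[of \<omega> 1] by auto
qed

section \<open>Transport of holes to all small scales\<close>

lemma directed_porous_limit_set:
  assumes "\<And>x. x \<in> (\<Union>e\<in>E. \<phi> e ` X) \<Longrightarrow>
      (interior X \<inter> parallel_line v x) - (\<Union>e\<in>E. \<phi> e ` X) \<noteq> {}"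
  shows "directed_porous v (limit_set E X \<phi>)"
proof -
  let ?J = "limit_set E X \<phi>" and ?K = "\<Union>e\<in>E. \<phi> e ` X"
  obtain m t :: real and s b where st: "0 < m" "t < 1" "\<And>e. e \<in> E \<Longrightarrow> m \<le> s e \<and> s e \<le> t"
    and \<phi>: "\<And>e. e \<in> E \<Longrightarrow> \<phi> e = (\<lambda>x. s e *\<^sub>R x + b e)"
    using similarity_bounds by blast
  have t: "0 < t" using st E_nonempty by force
  have "compact ?K" using finite_E compact_image_X by blast
  have "?K \<subseteq> X" using maps_X by blast
  have "open (interior X - ?K)"
    using \<open>compact ?K\<close> by (intro open_Diff compact_imp_closed open_interior)
  moreover have "(interior X - ?K) \<inter> parallel_line v x \<noteq> {}" if "x \<in> ?K" for x
    using assms[OF that] by blast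
  ultimately obtain \<rho> where "\<rho> > 0"
    and hole: "\<And>x. x \<in> ?K \<Longrightarrow> \<exists>y\<in>parallel_line v x. ball y \<rho> \<subseteq> interior X - ?K"
    using uniform_holes[OF \<open>compact ?K\<close>, of "interior X - ?K" v] by meson
  \<comment> \<open>The added 1 makes the open ball of radius \<open>D\<close> around any point of
    \<open>X\<close> contain \<open>X\<close>, and keeps \<open>D\<close> positive.\<close>
  define D where "D = diameter X + 1"
  have bX: "bounded X" using compact_X compact_imp_bounded by blast
  have "D > 0" using diameter_ge_0[OF bX] by (simp add: D_def)
  have XD: "X \<subseteq> ball x D" if "x \<in> X" for x
    using diameter_bounded_bound[OF bX \<open>x \<in> X\<close>] by (force simp: D_def)
  \<comment> \<open>Chosen so that \<open>c * r = \<rho>\<close> at the largest scale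
    \<open>r = D / m\<close>.\<close>
  define c where "c = \<rho> * m / D"
  have "c > 0" using \<open>\<rho> > 0\<close> \<open>D > 0\<close> st by (simp add: c_def)
  text \<open>
    At scales \<open>D \<le> r \<le> D / m\<close> the ball \<open>ball x r\<close> contains \<open>X\<close>. A smaller scale is multiplied by
    \<open>1 / s a\<close>, at most \<open>1 / m\<close>, on passing from \<open>x = \<phi> a x'\<close> to \<open>x'\<close>, so this range is never
    jumped over.
  \<close>
  have scaled_hole: "\<exists>y\<in>parallel_line v x. ball y (c * r) \<subseteq> interior X \<inter> ball x r - ?J"
    if "x \<in> ?J" "D * t ^ n \<le> r" "r \<le> D / m" for n x r
    using that
  proof (induction n arbitrary: x r)
    case 0
    then have "x \<in> ?K" using limit_set_subset by blast
    then obtain y where y: "y \<in> parallel_line v x" "ball y \<rho> \<subseteq> interior X - ?K" using hole by blast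
    have "c * r \<le> c * (D / m)" using 0 \<open>c > 0\<close> by (intro mult_left_mono) auto
    also have "\<dots> = \<rho>" using \<open>D > 0\<close> st by (simp add: c_def)
    finally have "ball y (c * r) \<subseteq> interior X - ?K" using y by force
    moreover have "X \<subseteq> ball x r"
      using XD[of x] \<open>x \<in> ?K\<close> \<open>?K \<subseteq> X\<close> 0 by (force simp: subset_iff)
    ultimately have "ball y (c * r) \<subseteq> interior X \<inter> ball x r - ?J"
      using limit_set_subset interior_subset[of X] by blast
    then show ?case using y by blast
  next
    \<comment> \<open>A transported hole lies inside a first-level image, hence in
      \<open>?K\<close>, so only \<open>?J\<close> can still be avoided. Containment in
      \<open>interior X\<close> is carried along because the open set condition concerns
      interiors.\<close>
    case (Suc n)
    show ?case
    proof (cases "D * t ^ n \<le> r")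
      case True
      then show ?thesis using Suc by blast
    next
      case False
      obtain a x' where a: "a \<in> E" and x': "x' \<in> ?J" "x = \<phi> a x'"
        using limit_set_subset_images Suc.prems(1) by blast
      have sa: "m \<le> s a" "s a \<le> t" "0 < s a" using st a by force+
      have "0 < D * t ^ Suc n" using \<open>D > 0\<close> t by simp
      then have "0 < r" using Suc.prems by linarith
      have "s a * (D * t ^ n) \<le> t * (D * t ^ n)"
        using sa \<open>D > 0\<close> t by (intro mult_right_mono) auto
      then have "D * t ^ n \<le> r / s a"
        using Suc.prems sa by (simp add: field_simps)
      \<comment> \<open>In this case \<open>r < D * t ^ n \<le> D\<close>, so dividing by
        \<open>s a \<ge> m\<close> does not exceed \<open>D / m\<close>.\<close>
      moreover have "D * t ^ n \<le> D * 1"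
        using \<open>D > 0\<close> t st by (intro mult_left_mono power_le_one) auto
      then have "r / s a \<le> D / m"
        using False sa st \<open>0 < r\<close> by (intro frac_le) auto
      ultimately obtain y where y: "y \<in> parallel_line v x'"
        "ball y (c * (r / s a)) \<subseteq> interior X \<inter> ball x' (r / s a) - ?J"
        using Suc.IH x' by blast
      have image_ball: "\<phi> a ` ball z d = ball (\<phi> a z) (s a * d)" for z d
        using image_ball_similarity sa by (simp add: \<phi>[OF a])
      \<comment> \<open>A point of \<open>?J\<close> in the image ball has a first letter
        \<open>e\<close>. Disjointness forces \<open>e = a\<close>, and injectivity of
        \<open>\<phi> a\<close> then puts its preimage \<open>q\<close> in \<open>?J\<close>,
        although \<open>q\<close> lies in the hole.\<close>
      have "\<phi> a ` ball y (c * (r / s a)) \<inter> ?J = {}"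
      proof (intro equals0I, elim IntE imageE)
        fix p q assume p: "p \<in> ?J" "p = \<phi> a q" "q \<in> ball y (c * (r / s a))"
        then have q: "q \<in> interior X" "q \<notin> ?J" using y by blast+
        obtain e p' where e: "e \<in> E" "p' \<in> ?J" "p = \<phi> e p'"
          using limit_set_subset_images p by blast
        have "p' \<in> X" using e limit_set_subset \<open>?K \<subseteq> X\<close> by blast
        then have "e = a"
          using interior_image_disjoint[OF a \<open>e \<in> E\<close>] q e p by blast
        then have "p' = q" using e p sa by (simp add: \<phi>[OF a])
        then show False using e q by simp
      qed
      moreover have "\<phi> a ` ball y (c * (r / s a)) \<subseteq> interior X"
        using y image_interior_X(2)[OF a] by blast
      moreover have "\<phi> a ` ball y (c * (r / s a)) \<subseteq> \<phi> a ` ball x' (r / s a)"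
        using y by blast
      \<comment> \<open>The factor \<open>s a\<close> cancels in both radii, so the same
        \<open>c\<close> survives every level.\<close>
      ultimately have "ball (\<phi> a y) (c * r) \<subseteq> interior X \<inter> ball x r - ?J"
        using sa x' unfolding image_ball by (auto simp: mult.left_commute[of "s a"])
      moreover have "\<phi> a y \<in> parallel_line v x"
        using y x' by (auto simp: parallel_line_iff \<phi>[OF a] scaleR_add_right)
      ultimately show ?thesis by blast
    qed
  qed
  \<comment> \<open>The minimum with \<open>1/2\<close> secures the bound below 1 demanded by
    \<open>directed_porous\<close>; \<open>D / m\<close> serves as \<open>r0\<close>.\<close>
  have "min c (1/2) \<le> directed_por v ?J x r" if "x \<in> ?J" "0 < r" "r < D / m" for x r
  proof -
    obtain n where "t ^ n < r / D"
      using real_arch_pow_inv[of "r / D" t] st \<open>D > 0\<close> \<open>0 < r\<close> by auto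
    then have "D * t ^ n \<le> r" using \<open>D > 0\<close> by (simp add: field_simps)
    then obtain y where "y \<in> parallel_line v x" "ball y (c * r) \<subseteq> interior X \<inter> ball x r - ?J"
      using scaled_hole[of x n r] \<open>x \<in> ?J\<close> \<open>r < D / m\<close> by force
    then have "c \<le> directed_por v ?J x r"
      using \<open>c > 0\<close> \<open>0 < r\<close> by (intro le_directed_por[where y = y]) auto
    then show ?thesis by linarith
  qed
  moreover have "bounded ?J"
    using bX limit_set_subset \<open>?K \<subseteq> X\<close> bounded_subset by (meson order_trans)
  moreover have "0 < min c (1/2)" "min c (1/2) < 1" "0 < D / m"
    using \<open>c > 0\<close> \<open>D > 0\<close> st by auto
  ultimately show ?thesis unfolding directed_porous_def by blast
qed

end

theorem theorem3p13:
  fixes E :: "'e set" and X :: "(real ^ 'n) set" and \<phi> :: "'e \<Rightarrow> real ^ 'n \<Rightarrow> real ^ 'n"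
    and V :: "(real ^ 'n) set"
  assumes "rotation_free_cifs E X \<phi>"
    and "V \<subseteq> sphere 0 1"
    and "\<forall>x \<in> (\<Union>e\<in>E. \<phi> e ` X). \<forall>v \<in> sphere 0 1 - V.
           (interior X \<inter> parallel_line v x) - (\<Union>e\<in>E. \<phi> e ` X) \<noteq> {}"
  shows "\<forall>v \<in> sphere 0 1 - V. directed_porous v (limit_set E X \<phi>)"
  using rotation_free_cifs.directed_porous_limit_set[OF assms(1)] assms(3) by blast

end
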